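(* Let $X$ be a Banach space, $A\in B(X)$, and let $K_n:X\to X$ be a compact (in general nonlinear) map for each $n\in\mathbb N$. Let $(a_n)_{n=1}^\infty$ be a sequence in $[0,\infty)$ with $\lim_{n\to\infty}a_n=0$, and let $L\subset\mathbb N$ be infinite. For $x\in X$ and $n\in\mathbb N$ define $$f_n(x)=(A+K_n)\cdots(A+K_1)x.$$ Then the set $$\bigl\{x\in X:\ \text{there are infinitely many } n\in L\text{ with }\|f_n(x)\|\ge a_n\|A^n\|_\mu\bigr\}$$ is residual in $X$.
   Context: All Banach spaces are complex and infinite-dimensional. A map $K:X\to X$ is compact if it is continuous and maps bounded sets to precompact sets. For $A\in B(X)$, $$\|A\|_\mu=\inf\{\|A\upharpoonright_M\|:\ M\subset X\text{ is a closed subspace},\ \operatorname{codim}M<\infty\}.$$ A set is residual if it contains a dense $G_\delta$ set (equivalently, its complement is of first category). *)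

theory Defs
  imports "HOL-Analysis.Analysis"
begin

text \<open>
  HOL-Analysis only knows real normed spaces, so complex Banach spaces are introduced as
  real Banach spaces with a compatible complex scalar multiplication. The norm, topology and
  completeness are those of the underlying real Banach space.
\<close>

class complex_vector = real_vector +
  fixes scaleC :: "complex \<Rightarrow> 'a \<Rightarrow> 'a" (infixr "*\<^sub>C" 75)
  assumes scaleC_add_right: "c *\<^sub>C (x + y) = c *\<^sub>C x + c *\<^sub>C y"
    and scaleC_add_left: "(c + d) *\<^sub>C x = c *\<^sub>C x + d *\<^sub>C x"
    and scaleC_scaleC: "c *\<^sub>C (d *\<^sub>C x) = (c * d) *\<^sub>C x"
    and scaleC_one: "1 *\<^sub>C x = x"
    and scaleR_scaleC: "r *\<^sub>R x = complex_of_real r *\<^sub>C x"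

class complex_normed_vector = complex_vector + real_normed_vector +
  assumes norm_scaleC: "norm (c *\<^sub>C x) = cmod c * norm x"

class complex_banach = complex_normed_vector + banach

instantiation complex :: complex_banach
begin

definition scaleC_complex :: "complex \<Rightarrow> complex \<Rightarrow> complex"
  where "scaleC_complex c x = c * x"

instance
  by standard
    (simp_all add: scaleC_complex_def algebra_simps norm_mult scaleR_conv_of_real)

end

global_interpretation complex_vector: vector_space "scaleC :: complex \<Rightarrow> 'a \<Rightarrow> 'a :: complex_vector"
  defines csubspace = complex_vector.subspace
    and cspan = complex_vector.span
  by unfold_locales
    (simp_all add: scaleC_add_right scaleC_add_left scaleC_scaleC scaleC_one)

definition infinite_cdim :: "'a :: complex_vector itself \<Rightarrow> bool"
  where "infinite_cdim _ \<longleftrightarrow> \<not> (\<exists>F :: 'a set. finite F \<and> cspan F = UNIV)"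

text \<open>The cosets of finitely many vectors span the quotient space by \<open>M\<close>.\<close>

definition finite_codim :: "'a :: complex_vector set \<Rightarrow> bool"
  where "finite_codim M \<longleftrightarrow> (\<exists>F. finite F \<and> (\<forall>x. \<exists>y \<in> cspan F. x - y \<in> M))"

definition bounded_clinear :: "('a :: complex_normed_vector \<Rightarrow> 'b :: complex_normed_vector) \<Rightarrow> bool"
  where "bounded_clinear A \<longleftrightarrow>
    Vector_Spaces.linear scaleC scaleC A \<and> (\<exists>B. \<forall>x. norm (A x) \<le> B * norm x)"

text \<open>
  Operator norm of a restriction, in the style of \<^const>\<open>onorm\<close>. By \<open>0 / 0 = 0\<close> it is
  \<open>0\<close> on the zero subspace; it is meaningful for bounded linear operators only.
\<close>

definition onorm_on :: "'a :: real_normed_vector set \<Rightarrow> ('a \<Rightarrow> 'b :: real_normed_vector) \<Rightarrow> real"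
  where "onorm_on M A = (SUP x\<in>M. norm (A x) / norm x)"

definition mu_norm :: "('a :: complex_normed_vector \<Rightarrow> 'a) \<Rightarrow> real"
  where "mu_norm A = Inf {onorm_on M A | M. csubspace M \<and> closed M \<and> finite_codim M}"

definition compact_map :: "('a :: metric_space \<Rightarrow> 'b :: metric_space) \<Rightarrow> bool"
  where "compact_map K \<longleftrightarrow>
    continuous_on UNIV K \<and> (\<forall>B. bounded B \<longrightarrow> compact (closure (K ` B)))"

definition residual :: "'a :: topological_space set \<Rightarrow> bool"
  where "residual S \<longleftrightarrow> (\<exists>G. gdelta G \<and> closure G = UNIV \<and> G \<subseteq> S)"

primrec perturbed_iterate :: "('a :: plus \<Rightarrow> 'a) \<Rightarrow> (nat \<Rightarrow> 'a \<Rightarrow> 'a) \<Rightarrow> nat \<Rightarrow> 'a \<Rightarrow> 'a"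
  where
    "perturbed_iterate A K 0 x = x"
  | "perturbed_iterate A K (Suc n) x =
       A (perturbed_iterate A K n x) + K (Suc n) (perturbed_iterate A K n x)"

end

theory Submission
  imports Defs
begin

text \<open>
  Expanding the product shows that \<open>f n = A ^^ n + C\<close> with a compact map \<open>C\<close>
  (\<open>perturbed_iterate_compact\<close>), so the problem is to see that a compact perturbation cannot
  keep a linear operator \<open>T\<close> small on a whole ball. Suppose that \<open>norm (T x + C x) \<le> s\<close> on the
  ball of radius \<open>\<epsilon>\<close> about \<open>x0\<close>. Since \<open>C\<close> takes values in a compact set there, the image of
  the ball of radius \<open>\<epsilon>\<close> about \<open>0\<close> under \<open>T\<close> is covered by finitely many balls whose radius
  \<open>r\<close> is as close to \<open>s\<close> as desired. Take for each centre \<open>y\<close> a functional of norm at most one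
  which attains the value \<open>norm y\<close> at \<open>y\<close>, and let \<open>M\<close> be the set of the \<open>x\<close> for which all these
  functionals vanish at \<open>T x\<close>; it is a closed subspace of finite codimension. If \<open>x \<in> M\<close> and
  \<open>T x\<close> is within \<open>r\<close> of the centre \<open>y\<close>, then the functional of \<open>y\<close> gives
  \<open>norm y \<le> norm (y - T x) \<le> r\<close>, so \<open>norm (T x) \<le> 2 * r\<close>. Hence
  \<open>mu_norm T \<le> 2 * r / \<epsilon>\<close> (\<open>mu_norm_le_finite_cover\<close>), and in the limit
  \<open>\<epsilon> * mu_norm T \<le> 2 * s\<close> (\<open>compact_perturbation_large_values\<close>).

  For \<open>s = a n * mu_norm (A ^^ n)\<close> with \<open>mu_norm (A ^^ n) > 0\<close> this is impossible as soon as
  \<open>2 * a n < \<epsilon>\<close>. As \<open>a\<close> tends to \<open>0\<close>, the open sets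
  \<open>{x. norm (f n x) > a n * mu_norm (A ^^ n)}\<close> over the \<open>n \<in> L\<close> beyond any given
  index with \<open>mu_norm (A ^^ n) > 0\<close> have a dense union, provided that there are infinitely many
  such \<open>n\<close>, and Baire's theorem shows that the points in infinitely many of these sets form a
  residual set. Otherwise infinitely many \<open>n \<in> L\<close> have \<open>mu_norm (A ^^ n) = 0\<close>, and for them the
  required inequality holds at every point.

  The norming functionals come from the Hahn-Banach theorem, which is obtained here by finding a
  minimal sublinear functional with Zorn's lemma: minimality forces linearity.
\<close>

section \<open>Norming functionals\<close>

definition sublinear :: "('a :: real_vector \<Rightarrow> real) \<Rightarrow> bool"
  where "sublinear p \<longleftrightarrow>
    (\<forall>x y. p (x + y) \<le> p x + p y) \<and> (\<forall>r\<ge>0. \<forall>x. p (r *\<^sub>R x) = r * p x)"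

lemma sublinear_add: "sublinear p \<Longrightarrow> p (x + y) \<le> p x + p y"
  and sublinear_scaleR: "sublinear p \<Longrightarrow> 0 \<le> r \<Longrightarrow> p (r *\<^sub>R x) = r * p x"
  by (simp_all add: sublinear_def)

lemma sublinear_zero: "sublinear p \<Longrightarrow> p 0 = 0"
  using sublinear_scaleR[of p 0 0] by simp

lemma sublinear_minus: "sublinear p \<Longrightarrow> - p (- x) \<le> p x"
  using sublinear_add[of p x "- x"] sublinear_zero[of p] by simp

text \<open>
  The inequality for a scalar \<open>r > 0\<close> already gives equality, because it can be applied to
  \<open>1 / r\<close> as well.
\<close>

lemma sublinearI:
  assumes add: "\<And>x y. p (x + y) \<le> p x + p y"
    and scale: "\<And>r x. 0 < r \<Longrightarrow> p (r *\<^sub>R x) \<le> r * p x"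
  shows "sublinear p"
proof -
  have "p (r *\<^sub>R x) = r * p x" if "0 \<le> r" for r x
  proof (cases "r = 0")
    case True
    have "0 \<le> p 0" using add[of 0 0] by simp
    moreover have "p 0 \<le> 0" using scale[of "1/2" 0] by simp
    ultimately show ?thesis using True by simp
  next
    case False
    then have r: "0 < r" using that by simp
    have "p ((1 / r) *\<^sub>R (r *\<^sub>R x)) \<le> (1 / r) * p (r *\<^sub>R x)"
      using r by (intro scale) simp
    then have "r * p x \<le> p (r *\<^sub>R x)"
      using r by (simp add: field_simps)
    then show ?thesis using scale[OF r, of x] by simp
  qed
  then show ?thesis using add by (simp add: sublinear_def)
qed

text \<open>
  The result of pushing \<open>p\<close> down in the direction \<open>- y\<close>: it is again sublinear, it lies below
  \<open>p\<close>, and its value at \<open>- y\<close> is at most \<open>- p y\<close>. A linear functional below it therefore is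
  at least \<open>p y\<close> at \<open>y\<close>.
\<close>

definition descent :: "('a :: real_vector \<Rightarrow> real) \<Rightarrow> 'a \<Rightarrow> 'a \<Rightarrow> real"
  where "descent p y x = (INF t\<in>{0..}. p (x + t *\<^sub>R y) - t * p y)"

lemma descent_lower:
  assumes "sublinear p" and "0 \<le> t"
  shows "descent p y x \<le> p (x + t *\<^sub>R y) - t * p y"
proof -
  have "- p (- x) \<le> p (x + s *\<^sub>R y) - s * p y" if "0 \<le> s" for s
    using sublinear_add[OF assms(1), of "x + s *\<^sub>R y" "- x"]
      sublinear_scaleR[OF assms(1) that, of y] by simp
  then have "bdd_below ((\<lambda>s. p (x + s *\<^sub>R y) - s * p y) ` {0..})"
    by (intro bdd_belowI[of _ "- p (- x)"]) auto
  then show ?thesis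
    unfolding descent_def using assms(2) by (intro cINF_lower) auto
qed

lemma descent_greatest:
  "(\<And>t. 0 \<le> t \<Longrightarrow> c \<le> p (x + t *\<^sub>R y) - t * p y) \<Longrightarrow> c \<le> descent p y x"
  unfolding descent_def by (rule cINF_greatest) auto

lemma descent_le: "sublinear p \<Longrightarrow> descent p y x \<le> p x"
  using descent_lower[of p 0 y x] by simp

lemma descent_minus: "sublinear p \<Longrightarrow> descent p y (- y) \<le> - p y"
  using descent_lower[of p 1 y "- y"] sublinear_zero[of p] by simp

lemma sublinear_descent:
  assumes p: "sublinear p"
  shows "sublinear (descent p y)"
proof (rule sublinearI)
  fix u v
  have "descent p y (u + v) - descent p y u \<le> p (v + t *\<^sub>R y) - t * p y" if t: "0 \<le> t" for t
  proof -
    have "descent p y (u + v) - (p (v + t *\<^sub>R y) - t * p y) \<le> p (u + s *\<^sub>R y) - s * p y"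
      if s: "0 \<le> s" for s
    proof -
      have "descent p y (u + v) \<le> p ((u + v) + (s + t) *\<^sub>R y) - (s + t) * p y"
        using s t by (intro descent_lower[OF p]) simp
      also have "(u + v) + (s + t) *\<^sub>R y = (u + s *\<^sub>R y) + (v + t *\<^sub>R y)"
        by (simp add: algebra_simps)
      also have "p \<dots> \<le> p (u + s *\<^sub>R y) + p (v + t *\<^sub>R y)"
        by (rule sublinear_add[OF p])
      finally show ?thesis by (simp add: algebra_simps)
    qed
    from descent_greatest[OF this] show ?thesis by simp
  qed
  from descent_greatest[OF this] show "descent p y (u + v) \<le> descent p y u + descent p y v"
    by simp
next
  fix r :: real and u
  assume r: "0 < r"
  have "(1 / r) * descent p y (r *\<^sub>R u) \<le> p (u + t *\<^sub>R y) - t * p y" if t: "0 \<le> t" for t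
  proof -
    have "descent p y (r *\<^sub>R u) \<le> p (r *\<^sub>R u + (r * t) *\<^sub>R y) - (r * t) * p y"
      using r t by (intro descent_lower[OF p]) simp
    also have "r *\<^sub>R u + (r * t) *\<^sub>R y = r *\<^sub>R (u + t *\<^sub>R y)"
      by (simp add: algebra_simps)
    also have "p \<dots> = r * p (u + t *\<^sub>R y)"
      using r by (intro sublinear_scaleR[OF p]) simp
    finally show ?thesis using r by (simp add: field_simps)
  qed
  from descent_greatest[OF this] show "descent p y (r *\<^sub>R u) \<le> r * descent p y u"
    using r by (simp add: field_simps)
qed

text \<open>
  A minimal \<open>q\<close> coincides with its descent in every direction, so \<open>q (- y) = - q y\<close>. An odd
  sublinear functional is also superadditive, hence linear.
\<close>

lemma minimal_sublinear_imp_linear: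
  assumes q: "sublinear q" and min: "\<And>q'. sublinear q' \<Longrightarrow> q' \<le> q \<Longrightarrow> q' = q"
  shows "linear q"
proof -
  have "descent q y = q" for y
    using q by (intro min sublinear_descent) (auto simp: le_fun_def descent_le)
  then have minus: "q (- y) = - q y" for y
    using descent_minus[OF q, of y] sublinear_minus[OF q, of y] by simp
  show ?thesis
  proof (rule linearI)
    fix x y
    show "q (x + y) = q x + q y"
      using sublinear_add[OF q, of x y] sublinear_add[OF q, of "x + y" "- y"] minus[of y] by simp
  next
    fix r x
    show "q (r *\<^sub>R x) = r *\<^sub>R q x"
      using sublinear_scaleR[OF q, of r x] sublinear_scaleR[OF q, of "- r" x] minus[of "r *\<^sub>R x"]
      by (cases "0 \<le> r") auto
  qed
qed

text \<open>
  The infimum is finite because a sublinear functional below \<open>p\<close> is bounded from below by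
  \<open>- p (- x)\<close> at \<open>x\<close>.
\<close>

lemma sublinear_chain_Inf:
  assumes "C \<noteq> {}" and sub: "\<And>q. q \<in> C \<Longrightarrow> sublinear q \<and> q \<le> p"
    and chain: "\<And>q q'. q \<in> C \<Longrightarrow> q' \<in> C \<Longrightarrow> q \<le> q' \<or> q' \<le> q"
  shows "sublinear (\<lambda>x. INF q\<in>C. q x)" and "\<And>q. q \<in> C \<Longrightarrow> (\<lambda>x. INF q\<in>C. q x) \<le> q"
proof -
  define u where "u x = (INF q\<in>C. q x)" for x
  have "- p (- x) \<le> q x" if "q \<in> C" for q x
  proof -
    have "q (- x) \<le> p (- x)" using sub[OF that] by (simp add: le_fun_def)
    then show ?thesis using sublinear_minus[of q x] sub[OF that] by linarith
  qed
  then have "bdd_below ((\<lambda>q. q x) ` C)" for x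
    by (intro bdd_belowI[of _ "- p (- x)"]) auto
  then have lower: "u x \<le> q x" if "q \<in> C" for q x
    unfolding u_def using that by (intro cINF_lower) auto
  have greatest: "c \<le> u x" if "\<And>q. q \<in> C \<Longrightarrow> c \<le> q x" for c x
    unfolding u_def using that \<open>C \<noteq> {}\<close> by (intro cINF_greatest) auto
  have "sublinear u"
  proof (rule sublinearI)
    fix x y
    have *: "u (x + y) \<le> q x + q' y" if q: "q \<in> C" and q': "q' \<in> C" for q q'
    proof -
      \<comment> \<open>The smaller of the two functionals serves both arguments.\<close>
      obtain m where m: "m \<in> C" "m \<le> q" "m \<le> q'"
        using chain[OF q q'] q q' by auto
      have "u (x + y) \<le> m (x + y)" by (rule lower[OF m(1)])
      also have "\<dots> \<le> m x + m y" using sub[OF m(1)] by (simp add: sublinear_add)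
      also have "\<dots> \<le> q x + q' y" using m by (intro add_mono) (auto simp: le_fun_def)
      finally show ?thesis .
    qed
    have "u (x + y) - u x \<le> q' y" if q': "q' \<in> C" for q'
      using greatest[of "u (x + y) - q' y" x] *[OF _ q'] by (simp add: algebra_simps)
    then have "u (x + y) - u x \<le> u y" by (rule greatest)
    then show "u (x + y) \<le> u x + u y" by simp
  next
    fix r :: real and x
    assume r: "0 < r"
    have "(1 / r) * u (r *\<^sub>R x) \<le> q x" if "q \<in> C" for q
      using lower[OF that, of "r *\<^sub>R x"] sublinear_scaleR[of q r x] sub[OF that] r
      by (simp add: field_simps)
    then have "(1 / r) * u (r *\<^sub>R x) \<le> u x" by (rule greatest)
    then show "u (r *\<^sub>R x) \<le> r * u x"
      using r by (simp add: field_simps)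
  qed
  then show "sublinear (\<lambda>x. INF q\<in>C. q x)" by (simp add: u_def[abs_def])
  show "(\<lambda>x. INF q\<in>C. q x) \<le> q" if "q \<in> C" for q
    using lower[OF that] by (simp add: u_def le_fun_def)
qed

theorem Hahn_Banach_sublinear:
  fixes p :: "'a :: real_vector \<Rightarrow> real"
  assumes p: "sublinear p"
  obtains f where "linear f" and "\<And>x. f x \<le> p x"
proof -
  define S where "S = {q. sublinear q \<and> q \<le> p}"
  have "\<exists>m\<in>S. \<forall>q\<in>S. m \<ge> q \<longrightarrow> q = m"
  proof (rule predicate_Zorn)
    show "partial_order_on S (relation_of (\<ge>) S)"
      by (rule partial_order_on_relation_ofI) auto
    fix C
    assume C: "C \<in> Chains (relation_of (\<ge>) S)"
    then have CS: "C \<subseteq> S" and chain: "\<And>q q'. q \<in> C \<Longrightarrow> q' \<in> C \<Longrightarrow> q \<le> q' \<or> q' \<le> q"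
      by (auto simp: Chains_def relation_of_def)
    show "\<exists>u\<in>S. \<forall>q\<in>C. q \<ge> u"
    proof (cases "C = {}")
      case True
      then show ?thesis using p by (auto simp: S_def)
    next
      case False
      note inf = sublinear_chain_Inf[of C p, OF False _ chain]
      have le: "(\<lambda>x. INF q\<in>C. q x) \<le> q" if "q \<in> C" for q
        using CS that by (intro inf(2)) (auto simp: S_def)
      obtain q where q: "q \<in> C" using False by blast
      have "(\<lambda>x. INF q\<in>C. q x) \<le> p"
        using le[OF q] q CS by (auto simp: S_def intro: order_trans)
      moreover have "sublinear (\<lambda>x. INF q\<in>C. q x)"
        using CS by (intro inf(1)) (auto simp: S_def)
      ultimately show ?thesis using le by (auto simp: S_def)
    qed
  qed
  then obtain m where m: "sublinear m" "m \<le> p" and min: "\<And>q. q \<in> S \<Longrightarrow> q \<le> m \<Longrightarrow> q = m"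
    unfolding S_def by blast
  have "linear m"
  proof (rule minimal_sublinear_imp_linear[OF m(1)])
    fix q assume "sublinear q" "q \<le> m"
    then show "q = m" using m(2) by (intro min) (auto simp: S_def intro: order_trans)
  qed
  with m(2) that show thesis by (auto simp: le_fun_def)
qed

lemma sublinear_norm: "sublinear (norm :: 'a :: real_normed_vector \<Rightarrow> real)"
  by (simp add: sublinear_def norm_triangle_ineq)

text \<open>
  Hahn-Banach is applied to the descent of the norm in the direction \<open>- y\<close> instead of extending a
  functional from the line through \<open>y\<close>.
\<close>

lemma real_norming_functional:
  fixes y :: "'a :: real_normed_vector"
  obtains f :: "'a \<Rightarrow> real" where "linear f" and "f y = norm y" and "\<And>x. f x \<le> norm x"
proof -
  obtain f where f: "linear f" "\<And>x. f x \<le> descent norm y x"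
    using Hahn_Banach_sublinear[OF sublinear_descent[OF sublinear_norm]] by blast
  have le: "f x \<le> norm x" for x
    using f(2)[of x] descent_le[OF sublinear_norm, of y x] by linarith
  have "f (- y) \<le> - norm y"
    using f(2)[of "- y"] descent_minus[OF sublinear_norm, of y] by linarith
  then have "norm y \<le> f y"
    using linear_neg[OF f(1), of y] by simp
  with le[of y] have "f y = norm y" by simp
  with f(1) le that show thesis by blast
qed

abbreviation clinear :: "('a :: complex_vector \<Rightarrow> 'b :: complex_vector) \<Rightarrow> bool"
  where "clinear \<equiv> Vector_Spaces.linear scaleC scaleC"

lemma clinear_iff:
  "clinear f \<longleftrightarrow> (\<forall>x y. f (x + y) = f x + f y) \<and> (\<forall>c x. f (c *\<^sub>C x) = c *\<^sub>C f x)"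
  by (auto simp: Vector_Spaces.linear_iff complex_vector.vector_space_axioms)

lemma clinear_imp_linear: "clinear f \<Longrightarrow> linear f"
  unfolding clinear_iff by (intro linearI) (auto simp: scaleR_scaleC)

text \<open>
  A real functional \<open>f\<close> is the real part of the complex linear functional
  \<open>x \<mapsto> f x - \<i> * f (\<i> *\<^sub>C x)\<close>, which has the same norm.
\<close>

lemma complex_norming_functional:
  fixes y :: "'a :: complex_normed_vector"
  obtains \<phi> :: "'a \<Rightarrow> complex"
  where "clinear \<phi>" and "\<phi> y = norm y" and "\<And>x. norm (\<phi> x) \<le> norm x"
proof -
  obtain f :: "'a \<Rightarrow> real" where f: "linear f" "f y = norm y" "\<And>x. f x \<le> norm x"
    using real_norming_functional[of y] by blast
  define \<phi> where "\<phi> x = Complex (f x) (- f (\<i> *\<^sub>C x))" for x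
  have split: "c *\<^sub>C x = Re c *\<^sub>R x + Im c *\<^sub>R (\<i> *\<^sub>C x)" for c and x :: 'a
    by (simp add: scaleR_scaleC scaleC_scaleC flip: scaleC_add_left)
       (metis complex_eq mult.commute)
  have f_scale: "f (c *\<^sub>C x) = Re c * f x + Im c * f (\<i> *\<^sub>C x)" for c x
    by (subst split) (simp add: linear_add[OF f(1)] linear_scale[OF f(1)])
  have lin: "clinear \<phi>"
    unfolding clinear_iff
  proof (intro conjI allI)
    fix x z
    show "\<phi> (x + z) = \<phi> x + \<phi> z"
      by (simp add: \<phi>_def complex_eq_iff scaleC_add_right linear_add[OF f(1)])
  next
    fix c x
    show "\<phi> (c *\<^sub>C x) = c *\<^sub>C \<phi> x"
      by (simp add: \<phi>_def complex_eq_iff scaleC_scaleC scaleC_complex_def f_scale[of c]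
          f_scale[of "\<i> * c"] algebra_simps)
  qed
  have bound: "norm (\<phi> x) \<le> norm x" for x
  proof (cases "\<phi> x = 0")
    case False
    \<comment> \<open>Rotate \<open>x\<close> so that the value becomes real.\<close>
    define c where "c = cnj (\<phi> x) / norm (\<phi> x)"
    have c: "norm c = 1" using False by (simp add: c_def norm_divide)
    have "\<phi> (c *\<^sub>C x) = c * \<phi> x"
      using lin by (simp add: clinear_iff scaleC_complex_def)
    also have "\<dots> = norm (\<phi> x)"
      using False by (simp add: c_def mult.commute[of "cnj _"] complex_norm_square[symmetric]
          power2_eq_square)
    finally have "norm (\<phi> x) = Re (\<phi> (c *\<^sub>C x))" by simp
    also have "\<dots> = f (c *\<^sub>C x)" by (simp add: \<phi>_def)
    also have "\<dots> \<le> norm (c *\<^sub>C x)" by (rule f(3))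
    finally show ?thesis by (simp add: norm_scaleC c)
  qed simp
  have "\<phi> y = norm y"
  proof -
    have re: "Re (\<phi> y) = norm y" by (simp add: \<phi>_def f(2))
    have "(Re (\<phi> y))\<^sup>2 + (Im (\<phi> y))\<^sup>2 \<le> (norm y)\<^sup>2"
      using bound[of y] by (metis cmod_power2 norm_ge_zero power_mono)
    then have "Im (\<phi> y) = 0" using re by simp
    with re show ?thesis by (simp add: complex_eq_iff)
  qed
  with lin bound that show thesis by blast
qed

section \<open>The \<open>\<mu>\<close>-norm and finite coverings\<close>

text \<open>
  If \<open>g\<close> does not vanish on \<open>M\<close>, pick \<open>v \<in> M\<close> with \<open>g v \<noteq> 0\<close>; a multiple of \<open>v\<close>
  corrects any vector of \<open>M\<close> into the kernel, so one more spanning vector suffices.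
\<close>

lemma finite_codim_Int_kernel:
  fixes g :: "'a :: complex_vector \<Rightarrow> complex"
  assumes M: "csubspace M" and cod: "finite_codim M" and g: "clinear g"
  shows "finite_codim (M \<inter> {x. g x = 0})"
proof (cases "\<exists>v\<in>M. g v \<noteq> 0")
  case False
  then have "M \<inter> {x. g x = 0} = M" by auto
  with cod show ?thesis by simp
next
  case True
  then obtain v where v: "v \<in> M" "g v \<noteq> 0" by blast
  obtain F where F: "finite F" "\<And>x. \<exists>y \<in> cspan F. x - y \<in> M"
    using cod unfolding finite_codim_def by blast
  have "\<exists>y \<in> cspan (insert v F). x - y \<in> M \<inter> {x. g x = 0}" for x
  proof -
    obtain y where y: "y \<in> cspan F" "x - y \<in> M" using F(2) by blast
    define c where "c = g (x - y) / g v"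
    have "y \<in> cspan (insert v F)"
      using y(1) complex_vector.span_mono[of F "insert v F"] by blast
    then have "y + c *\<^sub>C v \<in> cspan (insert v F)"
      by (rule complex_vector.span_add)
        (intro complex_vector.span_scale complex_vector.span_base insertI1)
    moreover have "(x - y) - c *\<^sub>C v \<in> M"
      using y(2) v(1) M
      by (metis complex_vector.subspace_diff complex_vector.subspace_scale)
    moreover have "g ((x - y) - c *\<^sub>C v) = 0"
    proof -
      have "g (x - y) = g (((x - y) - c *\<^sub>C v) + c *\<^sub>C v)" by simp
      also have "\<dots> = g ((x - y) - c *\<^sub>C v) + c * g v"
        using g unfolding clinear_iff scaleC_complex_def by metis
      finally show ?thesis using v(2) by (simp add: c_def)
    qed
    ultimately show ?thesis by (intro bexI[of _ "y + c *\<^sub>C v"]) (auto simp: algebra_simps)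
  qed
  with F(1) show ?thesis unfolding finite_codim_def by blast
qed

lemma common_kernel:
  fixes g :: "'i \<Rightarrow> 'a :: complex_vector \<Rightarrow> complex"
  assumes "finite I" and "\<And>i. i \<in> I \<Longrightarrow> clinear (g i)"
  shows "csubspace {x. \<forall>i\<in>I. g i x = 0} \<and> finite_codim {x. \<forall>i\<in>I. g i x = 0}"
  using assms
proof (induction I rule: finite_induct)
  case empty
  have "finite_codim (UNIV :: 'a set)"
    unfolding finite_codim_def by (intro exI[of _ "{}"]) auto
  then show ?case by simp
next
  case (insert i I)
  have eq: "{x. \<forall>j\<in>insert i I. g j x = 0} = {x. \<forall>j\<in>I. g j x = 0} \<inter> {x. g i x = 0}"
    by auto
  have gi: "clinear (g i)" using insert.prems by simp
  have "csubspace {x. g i x = 0}"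
    using module_hom.subspace_kernel[of scaleC scaleC "g i"] gi
    by (simp add: Vector_Spaces.linear_def csubspace_def)
  then show ?case
    unfolding eq using insert finite_codim_Int_kernel[OF _ _ gi]
    by (auto intro: complex_vector.subspace_inter)
qed

lemma bounded_clinear_imp_bounded_linear:
  assumes "bounded_clinear T"
  shows "bounded_linear T"
proof -
  obtain B where B: "\<And>x. norm (T x) \<le> B * norm x"
    using assms unfolding bounded_clinear_def by blast
  have "linear T" using assms unfolding bounded_clinear_def by (blast intro: clinear_imp_linear)
  then show ?thesis
    by (intro bounded_linear_intro[of T B])
       (auto simp: linear_add linear_scale B mult.commute)
qed

lemma bounded_clinear_id: "bounded_clinear (\<lambda>x. x)"
  unfolding bounded_clinear_def clinear_iff by (auto intro: exI[of _ 1])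

lemma bounded_clinear_compose:
  assumes "bounded_clinear S" and "bounded_clinear T"
  shows "bounded_clinear (\<lambda>x. S (T x))"
proof -
  have "bounded_linear (\<lambda>x. S (T x))"
    using bounded_linear_compose[OF assms[THEN bounded_clinear_imp_bounded_linear]] .
  then obtain B where "\<And>x. norm (S (T x)) \<le> norm x * B"
    using bounded_linear.bounded by blast
  then show ?thesis
    using assms unfolding bounded_clinear_def clinear_iff by (auto intro!: exI[of _ B] simp: mult.commute)
qed

lemma bounded_clinear_funpow:
  fixes A :: "'a :: complex_normed_vector \<Rightarrow> 'a"
  assumes "bounded_clinear A"
  shows "bounded_clinear (A ^^ n)"
proof (induction n)
  case 0
  show ?case by (simp add: id_def bounded_clinear_id)
next
  case (Suc n)
  then show ?case unfolding funpow.simps comp_def by (rule bounded_clinear_compose[OF assms])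
qed

lemma onorm_on_nonneg:
  assumes "bounded_clinear T" and "csubspace M"
  shows "0 \<le> onorm_on M T"
proof -
  obtain B where B: "\<And>x. norm (T x) \<le> B * norm x"
    using assms unfolding bounded_clinear_def by blast
  have "norm (T x) / norm x \<le> max B 0" for x
  proof -
    have "norm (T x) \<le> max B 0 * norm x"
      using B[of x] mult_right_mono[of B "max B 0" "norm x"] by simp
    then show ?thesis by (cases "x = 0") (auto simp: divide_le_eq)
  qed
  then have "bdd_above ((\<lambda>x. norm (T x) / norm x) ` M)"
    by (intro bdd_aboveI[of _ "max B 0"]) auto
  moreover have "0 \<in> M" by (rule complex_vector.subspace_0[OF assms(2)])
  ultimately show ?thesis
    unfolding onorm_on_def using cSUP_upper[of 0 M "\<lambda>x. norm (T x) / norm x"] by simp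
qed

lemma mu_norm_le:
  assumes T: "bounded_clinear T"
    and M: "csubspace M" "closed M" "finite_codim M"
    and bound: "\<And>x. x \<in> M \<Longrightarrow> norm (T x) \<le> b * norm x" and "0 \<le> b"
  shows "mu_norm T \<le> b"
proof -
  have "mu_norm T \<le> onorm_on M T"
    unfolding mu_norm_def
    using M onorm_on_nonneg[OF T] by (intro cInf_lower bdd_belowI[of _ 0]) auto
  also have "\<dots> \<le> b"
    unfolding onorm_on_def
  proof (rule cSUP_least)
    show "M \<noteq> {}" using complex_vector.subspace_0[OF M(1)] by auto
    show "norm (T x) / norm x \<le> b" if "x \<in> M" for x
      using bound[OF that] \<open>0 \<le> b\<close> by (cases "x = 0") (auto simp: divide_le_eq)
  qed
  finally show ?thesis .
qed

text \<open>
  The \<open>\<mu>\<close>-norm is at most twice the ball measure of noncompactness of \<open>T\<close>. The factor 2 is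
  the price for killing the centres of the covering balls: on the common kernel of their norming
  functionals, composed with \<open>T\<close>, only centres of norm at most \<open>r\<close> can be within \<open>r\<close> of a
  value of \<open>T\<close>.
\<close>

lemma mu_norm_le_finite_cover:
  fixes T :: "'a :: complex_normed_vector \<Rightarrow> 'a"
  assumes T: "bounded_clinear T" and Y: "finite Y" and \<rho>: "0 < \<rho>"
    and cover: "\<And>u. norm u \<le> \<rho> \<Longrightarrow> \<exists>y\<in>Y. norm (T u - y) \<le> r"
  shows "mu_norm T \<le> 2 * r / \<rho>"
proof -
  interpret T: bounded_linear T by (rule bounded_clinear_imp_bounded_linear[OF T])
  have "\<exists>\<phi> :: 'a \<Rightarrow> complex. clinear \<phi> \<and> \<phi> y = norm y \<and> (\<forall>x. norm (\<phi> x) \<le> norm x)" for y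
    using complex_norming_functional[of y] by metis
  then obtain \<phi> :: "'a \<Rightarrow> 'a \<Rightarrow> complex" where \<phi>: "\<And>y. clinear (\<phi> y)" "\<And>y. \<phi> y y = norm y"
    "\<And>y x. norm (\<phi> y x) \<le> norm x"
    by metis
  define M where "M = {x. \<forall>y\<in>Y. \<phi> y (T x) = 0}"
  have lin: "clinear (\<lambda>x. \<phi> y (T x))" for y
    using \<phi>(1)[of y] T unfolding bounded_clinear_def clinear_iff by simp
  have sub: "csubspace M" and cod: "finite_codim M"
    unfolding M_def using common_kernel[OF Y lin] by auto
  have "bounded_linear (\<phi> y)" for y
    using clinear_imp_linear[OF \<phi>(1)] \<phi>(3)
    by (intro bounded_linear_intro[of _ 1]) (auto simp: linear_add linear_scale)
  then have cont: "continuous_on UNIV (\<lambda>x. \<phi> y (T x))" for y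
    by (intro linear_continuous_on bounded_linear_compose[of "\<phi> y" T] T.bounded_linear_axioms)
  have "M = (\<Inter>y\<in>Y. {x. \<phi> y (T x) = 0})" by (auto simp: M_def)
  then have clo: "closed M"
    using closed_Collect_eq[OF cont continuous_on_const] by auto
  have small: "norm (T u) \<le> 2 * r" if u: "u \<in> M" "norm u \<le> \<rho>" for u
  proof -
    obtain y where y: "y \<in> Y" "norm (T u - y) \<le> r" using cover[OF u(2)] by blast
    have "\<phi> y (y - T u) = \<phi> y y - \<phi> y (T u)"
      using linear_diff[OF clinear_imp_linear[OF \<phi>(1)]] .
    also have "\<dots> = norm y" using u(1) y(1) \<phi>(2) by (simp add: M_def)
    finally have "norm y = norm (\<phi> y (y - T u))" by simp
    also have "\<dots> \<le> norm (T u - y)" using \<phi>(3)[of y "y - T u"] by (simp add: norm_minus_commute)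
    finally show ?thesis using y(2) norm_triangle_sub[of "T u" y] by linarith
  qed
  have r: "0 \<le> r" using small[of 0] complex_vector.subspace_0[OF sub] \<rho> by simp
  have "norm (T x) \<le> 2 * r / \<rho> * norm x" if x: "x \<in> M" for x
  proof (cases "x = 0")
    case False
    have "(\<rho> / norm x) *\<^sub>R x \<in> M"
      unfolding scaleR_scaleC by (rule complex_vector.subspace_scale[OF sub x])
    from small[OF this] show ?thesis
      using False \<rho> by (simp add: T.scaleR field_simps)
  qed (simp add: T.zero)
  then show ?thesis using T sub clo cod r \<rho> by (intro mu_norm_le) auto
qed

section \<open>Compact perturbations\<close>

lemma compact_mapI:
  assumes "continuous_on UNIV K"
    and "\<And>B. bounded B \<Longrightarrow> \<exists>C. compact C \<and> K ` B \<subseteq> C"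
  shows "compact_map K"
  unfolding compact_map_def
proof (intro conjI allI impI assms(1))
  fix B :: "'a set" assume "bounded B"
  then obtain C where C: "compact C" "K ` B \<subseteq> C" using assms(2) by blast
  then have "closure (K ` B) \<subseteq> C" by (simp add: closure_minimal compact_imp_closed)
  then show "compact (closure (K ` B))"
    using C(1) compact_Int_closed[OF C(1) closed_closure] by (metis Int_absorb1)
qed

lemma compact_mapE:
  assumes "compact_map K" and "bounded B"
  obtains C where "compact C" and "K ` B \<subseteq> C"
  using assms closure_subset unfolding compact_map_def by metis

lemma compact_map_perturbation:
  fixes A :: "'a :: real_normed_vector \<Rightarrow> 'a"
  assumes A: "bounded_linear A" and C: "compact_map C" and K: "compact_map K"
    and f: "continuous_on UNIV f" "\<And>B. bounded B \<Longrightarrow> bounded (f ` B)"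
  shows "compact_map (\<lambda>x. A (C x) + K (f x))"
proof (rule compact_mapI)
  have "continuous_on UNIV C" "continuous_on UNIV K"
    using C K by (simp_all add: compact_map_def)
  then show "continuous_on UNIV (\<lambda>x. A (C x) + K (f x))"
    using f(1) by (intro continuous_on_add bounded_linear.continuous_on[OF A])
      (auto intro: continuous_on_compose2)
  fix B :: "'b set" assume B: "bounded B"
  obtain D where D: "compact D" "C ` B \<subseteq> D" using compact_mapE[OF C B] .
  obtain E where E: "compact E" "K ` (f ` B) \<subseteq> E" using compact_mapE[OF K f(2)[OF B]] .
  have "compact (A ` D)"
    using D(1) linear_continuous_on[OF A] by (intro compact_continuous_image)
  then have "compact {x + y |x y. x \<in> A ` D \<and> y \<in> E}"
    using E(1) by (rule compact_sums)
  moreover have "(\<lambda>x. A (C x) + K (f x)) ` B \<subseteq> {x + y |x y. x \<in> A ` D \<and> y \<in> E}"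
    using D(2) E(2) by blast
  ultimately show "\<exists>F. compact F \<and> (\<lambda>x. A (C x) + K (f x)) ` B \<subseteq> F" by blast
qed

text \<open>
  With \<open>f n = A ^^ n + C\<close>, the next remainder is \<open>x \<mapsto> A (C x) + K (Suc n) (f n x)\<close>. It is
  compact because \<open>f n\<close> is continuous and, being the sum of a bounded operator and a compact map,
  takes bounded sets to bounded sets.
\<close>

lemma perturbed_iterate_compact:
  fixes A :: "'a :: complex_normed_vector \<Rightarrow> 'a"
  assumes A: "bounded_clinear A" and K: "\<And>n. n \<ge> 1 \<Longrightarrow> compact_map (K n)"
  shows "\<exists>C. compact_map C \<and> perturbed_iterate A K n = (\<lambda>x. (A ^^ n) x + C x)"
proof (induction n)
  case 0
  have "compact_map (\<lambda>x :: 'a. 0 :: 'a)" by (intro compact_mapI) (auto intro: exI[of _ "{0}"])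
  then show ?case by (intro exI[of _ "\<lambda>_. 0"]) auto
next
  case (Suc n)
  interpret A: bounded_linear A by (rule bounded_clinear_imp_bounded_linear[OF A])
  have An: "bounded_linear (A ^^ n)"
    by (intro bounded_clinear_imp_bounded_linear bounded_clinear_funpow A)
  obtain C where C: "compact_map C" and eq: "perturbed_iterate A K n = (\<lambda>x. (A ^^ n) x + C x)"
    using Suc.IH by blast
  have cont: "continuous_on UNIV (perturbed_iterate A K n)"
    unfolding eq using C linear_continuous_on[OF An]
    by (intro continuous_on_add) (auto simp: compact_map_def)
  have bdd: "bounded (perturbed_iterate A K n ` B)" if B: "bounded B" for B
  proof -
    obtain D where D: "compact D" "C ` B \<subseteq> D" using compact_mapE[OF C B] .
    have "bounded (C ` B)" using D by (blast intro: bounded_subset compact_imp_bounded)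
    then show ?thesis
      unfolding eq using bounded_linear_image[OF B An] by (intro bounded_plus_comp)
  qed
  have "compact_map (\<lambda>x. A (C x) + K (Suc n) (perturbed_iterate A K n x))"
    using C K cont bdd by (intro compact_map_perturbation A.bounded_linear_axioms) auto
  moreover have "perturbed_iterate A K (Suc n) =
      (\<lambda>x. (A ^^ Suc n) x + (A (C x) + K (Suc n) (perturbed_iterate A K n x)))"
    by (rule ext) (simp add: eq A.add add.assoc)
  ultimately show ?case by blast
qed

text \<open>
  If \<open>norm (T x + C x) \<le> s\<close> held on the whole ball, then \<open>T u\<close> for \<open>norm u \<le> \<epsilon>\<close> would lie
  within \<open>s\<close> of the set of the points \<open>- C x - T x0\<close>, which is relatively compact and so up to
  \<open>\<delta>\<close> a finite set; this contradicts the bound on \<open>mu_norm T\<close> by finite coverings.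
\<close>

lemma compact_perturbation_large_values:
  fixes T :: "'a :: complex_normed_vector \<Rightarrow> 'a"
  assumes T: "bounded_clinear T" and C: "compact_map C"
    and \<epsilon>: "0 < \<epsilon>" and s: "2 * s < \<epsilon> * mu_norm T"
  obtains x where "x \<in> cball x0 \<epsilon>" and "s < norm (T x + C x)"
proof (rule ccontr)
  assume "\<not> thesis"
  with that have le: "\<And>x. x \<in> cball x0 \<epsilon> \<Longrightarrow> norm (T x + C x) \<le> s"
    by (meson not_less)
  interpret T: bounded_linear T by (rule bounded_clinear_imp_bounded_linear[OF T])
  obtain D where D: "compact D" "C ` cball x0 \<epsilon> \<subseteq> D"
    using compact_mapE[OF C bounded_cball] .
  \<comment> \<open>Half of the slack in \<open>s\<close>, so that still \<open>2 * (s + \<delta>) < \<epsilon> * mu_norm T\<close>.\<close>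
  define \<delta> where "\<delta> = (\<epsilon> * mu_norm T - 2 * s) / 4"
  have "0 < \<delta>" using s by (simp add: \<delta>_def)
  then obtain E where E: "finite E" "D \<subseteq> (\<Union>c\<in>E. ball c \<delta>)"
    using D(1) unfolding compact_eq_totally_bounded by blast
  have "mu_norm T \<le> 2 * (s + \<delta>) / \<epsilon>"
  proof (rule mu_norm_le_finite_cover[OF T _ \<epsilon>])
    show "finite ((\<lambda>c. - c - T x0) ` E)" using E(1) by simp
    fix u :: 'a assume u: "norm u \<le> \<epsilon>"
    define x where "x = x0 + u"
    have x: "x \<in> cball x0 \<epsilon>" using u by (simp add: x_def dist_norm)
    then obtain c where c: "c \<in> E" "dist c (C x) < \<delta>" using D(2) E(2) by fastforce
    have "T u - (- c - T x0) = (T x + C x) + (c - C x)"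
      by (simp add: x_def T.add)
    also have "norm \<dots> \<le> s + \<delta>"
      using le[OF x] c(2) by (intro norm_triangle_mono) (auto simp: dist_norm)
    finally show "\<exists>y\<in>(\<lambda>c. - c - T x0) ` E. norm (T u - y) \<le> s + \<delta>"
      using c(1) by blast
  qed
  then have "\<epsilon> * mu_norm T \<le> 2 * (s + \<delta>)" using \<epsilon> by (simp add: field_simps)
  moreover have "4 * \<delta> = \<epsilon> * mu_norm T - 2 * s" by (simp add: \<delta>_def)
  ultimately show False using s by (simp add: algebra_simps)
qed

section \<open>Residuality\<close>

lemma residual_infinitely_often:
  fixes U :: "nat \<Rightarrow> 'a :: complete_space set"
  assumes "\<And>n. open (U n)" and dense: "\<And>k. closure (\<Union>n\<in>{k..}. U n) = UNIV"
  shows "residual {x. infinite {n. x \<in> U n}}"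
proof -
  define V where "V k = (\<Union>n\<in>{k..}. U n)" for k
  have op: "open (V k)" for k using assms(1) by (auto simp: V_def)
  have "euclidean closure_of \<Inter> (range V) = topspace (euclidean :: 'a topology)"
  proof (rule Baire_category)
    show "completely_metrizable_space (euclidean :: 'a topology) \<or>
        locally_compact_space (euclidean :: 'a topology) \<and> regular_space (euclidean :: 'a topology)"
      using completely_metrizable_space_euclidean by blast
  qed (use op dense in \<open>auto simp: V_def\<close>)
  then have "closure (\<Inter> (range V)) = UNIV" by simp
  moreover have "gdelta (\<Inter> (range V))" using op by (rule gdelta.intros)
  moreover have "\<Inter> (range V) \<subseteq> {x. infinite {n. x \<in> U n}}"
    unfolding V_def infinite_nat_iff_unbounded_le by auto
  ultimately show ?thesis unfolding residual_def by blast
qed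

lemma residual_mono: "residual S \<Longrightarrow> S \<subseteq> S' \<Longrightarrow> residual S'"
  unfolding residual_def by blast

lemma residual_UNIV: "residual UNIV"
proof -
  have "gdelta (\<Inter>n::nat. UNIV :: 'a set)" by (rule gdelta.intros) simp
  then show ?thesis unfolding residual_def by (intro exI[of _ UNIV]) auto
qed

theorem theorem4p4:
  fixes A :: "'a :: complex_banach \<Rightarrow> 'a"
    and K :: "nat \<Rightarrow> 'a \<Rightarrow> 'a"
    and a :: "nat \<Rightarrow> real"
    and L :: "nat set"
  assumes "infinite_cdim TYPE('a)"
    and "bounded_clinear A"
    and "\<And>n. n \<ge> 1 \<Longrightarrow> compact_map (K n)"
    and "\<And>n. n \<ge> 1 \<Longrightarrow> 0 \<le> a n"
    and "a \<longlonglongrightarrow> 0"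
    and "L \<subseteq> {1..}"
    and "infinite L"
  shows "residual {x. infinite {n \<in> L. norm (perturbed_iterate A K n x) \<ge> a n * mu_norm (A ^^ n)}}"
proof -
  let ?f = "perturbed_iterate A K"
  let ?S = "{x. infinite {n \<in> L. norm (?f n x) \<ge> a n * mu_norm (A ^^ n)}}"
  define P where "P = {n \<in> L. 0 < mu_norm (A ^^ n)}"
  show ?thesis
  proof (cases "finite P")
    case True
    \<comment> \<open>For \<open>n \<in> L - P\<close> the right-hand side of the inequality is not positive.\<close>
    have inf: "infinite (L - P)" using True assms(7) by simp
    have "L - P \<subseteq> {n \<in> L. norm (?f n x) \<ge> a n * mu_norm (A ^^ n)}" for x
    proof
      fix n assume n: "n \<in> L - P"
      then have "0 \<le> a n" using assms(4)[of n] assms(6) by auto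
      then have "a n * mu_norm (A ^^ n) \<le> 0"
        using n by (intro mult_nonneg_nonpos) (auto simp: P_def)
      then show "n \<in> {n \<in> L. norm (?f n x) \<ge> a n * mu_norm (A ^^ n)}"
        using n by (auto intro: order_trans)
    qed
    then have "?S = UNIV" using inf by (auto dest: infinite_super)
    then show ?thesis by (simp add: residual_UNIV)
  next
    case False
    \<comment> \<open>Strict inequality makes the sets open.\<close>
    define U where
      "U n = (if n \<in> P then {x. a n * mu_norm (A ^^ n) < norm (?f n x)} else {})" for n
    have decomp: "\<exists>C. compact_map C \<and> ?f n = (\<lambda>x. (A ^^ n) x + C x)" for n
      using assms(2,3) by (rule perturbed_iterate_compact)
    have An: "bounded_clinear (A ^^ n)" for n
      using assms(2) by (rule bounded_clinear_funpow)
    have cont: "continuous_on UNIV (?f n)" for n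
    proof -
      obtain C where C: "compact_map C" and eq: "?f n = (\<lambda>x. (A ^^ n) x + C x)"
        using decomp by blast
      show ?thesis
        unfolding eq using C linear_continuous_on[OF bounded_clinear_imp_bounded_linear[OF An]]
        by (intro continuous_on_add) (auto simp: compact_map_def)
    qed
    have "residual {x. infinite {n. x \<in> U n}}"
    proof (rule residual_infinitely_often)
      show "open (U n)" for n
        using cont[of n] by (auto simp: U_def intro!: open_Collect_less continuous_intros)
      show "closure (\<Union>n\<in>{k..}. U n) = UNIV" for k
      proof -
        have "\<exists>x\<in>\<Union>n\<in>{k..}. U n. dist x x0 < e" if "0 < e" for x0 e
        proof -
          define \<epsilon> where "\<epsilon> = e / 2"
          have \<epsilon>: "0 < \<epsilon>" "\<epsilon> < e" using that by (auto simp: \<epsilon>_def)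
          have "eventually (\<lambda>n. a n < \<epsilon> / 2) sequentially"
            using assms(5) \<epsilon> by (intro order_tendstoD(2)) auto
          then obtain N where N: "\<And>n. N \<le> n \<Longrightarrow> a n < \<epsilon> / 2"
            by (auto simp: eventually_sequentially)
          obtain n where n: "n \<in> P" "max N k \<le> n"
            using False unfolding infinite_nat_iff_unbounded_le by blast
          then have "2 * (a n * mu_norm (A ^^ n)) < \<epsilon> * mu_norm (A ^^ n)"
            using N[of n] by (auto simp: P_def)
          moreover obtain C where C: "compact_map C" and eq: "?f n = (\<lambda>x. (A ^^ n) x + C x)"
            using decomp by blast
          ultimately obtain x where "x \<in> cball x0 \<epsilon>"
              "a n * mu_norm (A ^^ n) < norm ((A ^^ n) x + C x)"
            using compact_perturbation_large_values[OF An C \<epsilon>(1)] by blast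
          then have "x \<in> U n" "dist x x0 < e"
            using n(1) \<epsilon>(2) by (auto simp: U_def eq dist_commute)
          then show ?thesis using n(2) by auto
        qed
        then show ?thesis by (auto simp: closure_approachable)
      qed
    qed
    then show ?thesis
    proof (rule residual_mono, intro Collect_mono impI)
      fix x assume "infinite {n. x \<in> U n}"
      then show "infinite {n \<in> L. norm (?f n x) \<ge> a n * mu_norm (A ^^ n)}"
        by (rule infinite_super[rotated]) (auto simp: U_def P_def split: if_splits)
    qed
  qed
qed

end
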